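(* Let $A\in\mathbb{R}^{n\times n}$, $B\in\mathbb{R}^{n\times m}$, $D\in\mathbb{R}^{n\times r}$ be such that $(A,B)$ and $(A,D)$ are controllable. For every $P\in\mathbb{S}_{++}^n$, $$\lim_{\alpha\to 0^+} d_{\mathrm{BW}}^2(P,\alpha I_n)=\mathrm{tr}(P).$$ Consequently, in the limit $\alpha\to0^+$ the Bures--Wasserstein Gramian shaping problem with desired Gramian $P_d=\alpha I_n$ reduces to the $H_2$ state-feedback problem. That is, both problems have the same constraints on $(P,E)$, namely $P\in\mathbb{S}_{++}^n$, $E\in\mathbb{R}^{m\times n}$, and $AP+BE+PA^\top+E^\top B^\top+DD^\top=O_n$, and for each $(P,E)$ satisfying them the Gramian shaping objective $$\min\left\{\mathrm{tr}(P+\alpha I_n-2U)\ :\ U\in\mathbb{R}^{n\times n},\ \begin{bmatrix} P & U \\ {U}^\top & \alpha I_n \end{bmatrix}\succeq 0\right\}$$ converges, as $\alpha\to0^+$, to the $H_2$ objective $\mathrm{tr}(P)$.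
   Context: $\mathbb{S}_{+}^n$ and $\mathbb{S}_{++}^n$ denote the sets of real symmetric $n\times n$ positive semidefinite and positive definite matrices, respectively; $M\succeq 0$ means $M$ is symmetric positive semidefinite; $I_n$ and $O_n$ are the $n\times n$ identity and zero matrices. For $X,Y\in\mathbb{S}_+^n$, the Bures--Wasserstein distance is $$d_{\mathrm{BW}}(X,Y)=\left(\mathrm{tr}\left(X+Y-2\left(Y^{1/2}XY^{1/2}\right)^{1/2}\right)\right)^{1/2},$$ where $M^{1/2}$ denotes the unique positive semidefinite square root of $M\in\mathbb{S}_+^n$. The Gramian shaping problem with desired Gramian $P_d\in\mathbb{S}_{++}^n$ is: minimize $\mathrm{tr}(P+P_d-2U)$ over $P\in\mathbb{S}_{++}^n$, $E\in\mathbb{R}^{m\times n}$, $U\in\mathbb{R}^{n\times n}$ subject to $\begin{bmatrix} P & U \\ {U}^\top & P_d \end{bmatrix}\succeq0$ and $AP+BE+PA^\top+E^\top B^\top+DD^\top=O_n$. The $H_2$ state-feedback problem is: minimize $\mathrm{tr}(P)$ over $P\in\mathbb{S}_{++}^n$, $E\in\mathbb{R}^{m\times n}$ subject to $AP+BE+PA^\top+E^\top B^\top+DD^\top=O_n$. *)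

theory Defs
  imports "HOL-Analysis.Analysis"
begin

definition psd :: "real^'n^'n \<Rightarrow> bool" where
  "psd M \<longleftrightarrow> transpose M = M \<and> (\<forall>x. 0 \<le> x \<bullet> (M *v x))"

definition pos_def :: "real^'n^'n \<Rightarrow> bool" where
  "pos_def M \<longleftrightarrow> transpose M = M \<and> (\<forall>x. x \<noteq> 0 \<longrightarrow> 0 < x \<bullet> (M *v x))"

text \<open>Only meaningful for positive semidefinite arguments.\<close>

definition psd_sqrt :: "real^'n^'n \<Rightarrow> real^'n^'n" where
  "psd_sqrt M = (THE S. psd S \<and> S ** S = M)"

definition bures_wasserstein_dist :: "real^'n^'n \<Rightarrow> real^'n^'n \<Rightarrow> real" where
  "bures_wasserstein_dist X Y =
     sqrt (trace (X + Y - 2 *\<^sub>R psd_sqrt (psd_sqrt Y ** X ** psd_sqrt Y)))"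

definition block_matrix ::
  "real^'a^'c \<Rightarrow> real^'b^'c \<Rightarrow> real^'a^'d \<Rightarrow> real^'b^'d \<Rightarrow> real^('a + 'b)^('c + 'd)" where
  "block_matrix M11 M12 M21 M22 =
     (\<chi> i j. case i of
        Inl k \<Rightarrow> (case j of Inl l \<Rightarrow> M11 $ k $ l | Inr l \<Rightarrow> M12 $ k $ l)
      | Inr k \<Rightarrow> (case j of Inl l \<Rightarrow> M21 $ k $ l | Inr l \<Rightarrow> M22 $ k $ l))"

text \<open>
  Controllability of the continuous-time system \<open>x' = A x + B u\<close>: in any positive time,
  some integrable input steers any initial state to any final state. Trajectories are
  solutions in the integrated sense, so inputs need not be continuous.
\<close>

definition controllable :: "real^'n^'n \<Rightarrow> real^'m^'n \<Rightarrow> bool" where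
  "controllable A B \<longleftrightarrow>
     (\<forall>T>0. \<forall>x0 x1. \<exists>(u :: real \<Rightarrow> real^'m) (x :: real \<Rightarrow> real^'n).
        u absolutely_integrable_on {0..T} \<and> x 0 = x0 \<and> x T = x1 \<and>
        (\<forall>t\<in>{0..T}. ((\<lambda>s. A *v x s + B *v u s) has_integral (x t - x 0)) {0..t}))"

definition gramian_constraint ::
  "real^'n^'n \<Rightarrow> real^'m^'n \<Rightarrow> real^'r^'n \<Rightarrow> real^'n^'n \<Rightarrow> real^'n^'m \<Rightarrow> bool" where
  "gramian_constraint A B D P E \<longleftrightarrow>
     A ** P + B ** E + P ** transpose A + transpose E ** transpose B + D ** transpose D = 0"

definition shaping_lmi :: "real^'n^'n \<Rightarrow> real^'n^'n \<Rightarrow> (real^'n^'n) set" where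
  "shaping_lmi P Pd = {U. psd (block_matrix P U (transpose U) Pd)}"

definition shaping_cost :: "real^'n^'n \<Rightarrow> real^'n^'n \<Rightarrow> real^'n^'n \<Rightarrow> real" where
  "shaping_cost P Pd U = trace (P + Pd - 2 *\<^sub>R U)"

definition shaping_feasible ::
  "real^'n^'n \<Rightarrow> real^'m^'n \<Rightarrow> real^'r^'n \<Rightarrow> real^'n^'n
     \<Rightarrow> ((real^'n^'n) \<times> (real^'n^'m) \<times> (real^'n^'n)) set" where
  "shaping_feasible A B D Pd =
     {(P, E, U). pos_def P \<and> U \<in> shaping_lmi P Pd \<and> gramian_constraint A B D P E}"

definition h2_feasible ::
  "real^'n^'n \<Rightarrow> real^'m^'n \<Rightarrow> real^'r^'n \<Rightarrow> ((real^'n^'n) \<times> (real^'n^'m)) set" where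
  "h2_feasible A B D = {(P, E). pos_def P \<and> gramian_constraint A B D P E}"

end

theory Submission
  imports Defs
begin

text \<open>
  The term that couples \<open>P\<close> to \<open>\<alpha> I\<close> has diagonal entries of size \<open>O(sqrt \<alpha>)\<close>, both in the
  distance and in the objective, so only \<open>trace P\<close> survives in the limit
  (\<open>cost_tendsto_trace\<close>). In the distance this term is the square root \<open>S\<close> of \<open>\<alpha> P\<close>, and an entry
  of \<open>S\<close> in row \<open>i\<close> is bounded by the norm of that row, which is \<open>sqrt (\<alpha> P\<^sub>i\<^sub>i)\<close> because
  \<open>S S\<^sup>T = \<alpha> P\<close>. In the objective it is a feasible \<open>U\<close>, and the \<open>2 \<times> 2\<close> principal minors of
  the block matrix give \<open>U\<^sub>i\<^sub>j\<^sup>2 \<le> \<alpha> P\<^sub>i\<^sub>i\<close>. The same bound makes the feasible set compact, so the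
  minimum over \<open>U\<close> is attained; \<open>U = 0\<close> is feasible, so the matrix inequality does not restrict
  \<open>(P, E)\<close>.

  What takes work is that the square root is well defined. Existence is obtained without
  diagonalisation: Gaussian elimination yields some factorization \<open>P = L L\<^sup>T\<close>
  (\<open>psd_factorization\<close>), the set of all such \<open>L\<close> is compact and stable under \<open>L \<mapsto> L Q\<close> for
  orthogonal \<open>Q\<close>, and a factor of maximal trace must be symmetric and positive semidefinite
  (\<open>max_trace_psd\<close>), so that its square is \<open>P\<close>.
  Uniqueness is \<open>psd_sqrt_unique\<close>.
\<close>

section \<open>Positive semidefinite forms\<close>

lemma quadratic_nonneg_discriminant:
  fixes a b c :: real
  assumes "\<And>t. 0 \<le> a * t\<^sup>2 + 2 * b * t + c"
  shows "b\<^sup>2 \<le> a * c"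
proof (cases "a = 0")
  case True
  have "b = 0"
  proof (rule ccontr)
    assume "b \<noteq> 0"
    then show False
      using assms[of "- (c + 1) / (2 * b)"] True by simp
  qed
  then show ?thesis using True by simp
next
  case False
  have "0 \<le> c" using assms[of 0] by simp
  have "a > 0"
  proof (rule ccontr)
    assume "\<not> a > 0"
    then have a: "a < 0" using False by simp
    \<comment> \<open>So large that the negative leading term outweighs the other two.\<close>
    define t where "t = (2 * \<bar>b\<bar> + c + 1) / (- a) + 1"
    have t1: "t \<ge> 1" using a \<open>0 \<le> c\<close> by (simp add: t_def divide_nonneg_neg)
    have "a * t = - (2 * \<bar>b\<bar> + c + 1) + a" using a by (simp add: t_def field_simps)
    then have "a * t + 2 * b \<le> - (c + 1)" using a by linarith
    then have "(a * t + 2 * b) * t \<le> - (c + 1) * t" using t1 by (intro mult_right_mono) auto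
    also have "\<dots> \<le> - (c + 1)" using t1 \<open>0 \<le> c\<close> mult_left_mono[of 1 t "c + 1"] by simp
    finally show False using assms[of t] by (simp add: power2_eq_square algebra_simps)
  qed
  have "a * (b / a)\<^sup>2 = b\<^sup>2 / a" using False by (simp add: power2_eq_square)
  then have "0 \<le> c - b\<^sup>2 / a" using assms[of "- b / a"] by (simp add: power2_eq_square)
  then show ?thesis using \<open>a > 0\<close> by (simp add: field_simps)
qed

lemma symmetric_form:
  fixes M :: "real^'n^'n"
  assumes "transpose M = M"
  shows "x \<bullet> (M *v y) = y \<bullet> (M *v x)"
  using assms by (metis dot_lmul_matrix inner_commute transpose_matrix_vector)

lemma axis_form:
  fixes M :: "real^'n^'n"
  shows "axis i 1 \<bullet> (M *v axis j 1) = M $ i $ j"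
  by (simp add: inner_axis inner_axis' matrix_vector_mul_component)

lemma symmetric_entry:
  assumes "transpose M = M"
  shows "M $ i $ j = M $ j $ i"
proof -
  have "transpose M $ i $ j = M $ j $ i" by (simp add: transpose_def)
  then show ?thesis by (simp add: assms)
qed

lemma psd_Cauchy_Schwarz:
  fixes M :: "real^'n^'n"
  assumes "psd M"
  shows "(x \<bullet> (M *v y))\<^sup>2 \<le> (x \<bullet> (M *v x)) * (y \<bullet> (M *v y))"
proof (rule quadratic_nonneg_discriminant)
  fix t :: real
  have "0 \<le> (t *\<^sub>R x + y) \<bullet> (M *v (t *\<^sub>R x + y))"
    using assms by (simp add: psd_def)
  also have "\<dots> = (x \<bullet> (M *v x)) * t\<^sup>2 + 2 * (x \<bullet> (M *v y)) * t + y \<bullet> (M *v y)"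
    using symmetric_form[of M x y] assms
    by (simp add: psd_def matrix_vector_right_distrib matrix_vector_mult_scaleR
        inner_add_left inner_add_right power2_eq_square algebra_simps)
  finally show "0 \<le> \<dots>" .
qed

lemma psd_entry_bound:
  assumes "psd M"
  shows "(M $ i $ j)\<^sup>2 \<le> M $ i $ i * M $ j $ j"
  using psd_Cauchy_Schwarz[OF assms, of "axis i 1" "axis j 1"] by (simp add: axis_form)

lemma psd_kernel:
  assumes "psd M" and "x \<bullet> (M *v x) = 0"
  shows "M *v x = 0"
  using psd_Cauchy_Schwarz[OF assms(1), of "M *v x" x] assms(2) by simp

lemma pos_def_imp_psd: "pos_def M \<Longrightarrow> psd M"
  unfolding pos_def_def psd_def by (metis inner_zero_left order.refl less_imp_le)

section \<open>The square root\<close>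

text \<open>Symmetric Gaussian elimination: subtracting the rank-one matrix built from column \<open>k\<close> clears
  row and column \<open>k\<close>, and what remains is positive semidefinite by the Cauchy--Schwarz
  inequality. When the pivot vanishes, so does the whole row, and division by zero makes the same
  formula subtract nothing.\<close>

lemma psd_sum_rank_one:
  fixes P :: "real^'n^'n"
  assumes "finite K" and "psd P" and "\<And>i j. i \<notin> K \<Longrightarrow> P $ i $ j = 0"
  shows "\<exists>v :: 'n \<Rightarrow> real^'n. \<forall>i j. P $ i $ j = (\<Sum>k\<in>K. v k $ i * v k $ j)"
  using assms
proof (induction K arbitrary: P rule: finite_induct)
  case empty
  then show ?case by simp
next
  case (insert k F)
  have sym: "P $ i $ j = P $ j $ i" for i j
    using insert.prems(1) unfolding psd_def by (blast intro: symmetric_entry)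
  define p where "p = P $ k $ k"
  have p0: "p \<ge> 0"
    using insert.prems(1) axis_form[of k P k] unfolding p_def psd_def by metis
  define c where "c = P *v axis k 1"
  have c: "c $ i = P $ i $ k" for i
    by (simp add: c_def matrix_vector_mul_component inner_axis)
  have row: "P $ k $ j = 0" if "p = 0" for j
    using psd_entry_bound[OF insert.prems(1), of k j] that by (simp add: p_def)
  define P' :: "real^'n^'n" where "P' = (\<chi> i j. P $ i $ j - c $ i * c $ j / p)"
  have form: "x \<bullet> (P' *v x) = x \<bullet> (P *v x) - (x \<bullet> c)\<^sup>2 / p" for x
  proof -
    have "P' *v x = P *v x - ((c \<bullet> x) / p) *\<^sub>R c"
    proof -
      have "(P' *v x) $ i = (\<Sum>j\<in>UNIV. P $ i $ j * x $ j - c $ i / p * (c $ j * x $ j))" for i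
        by (simp add: P'_def matrix_vector_mult_def left_diff_distrib mult.assoc)
      then have "(P' *v x) $ i = (P *v x) $ i - c $ i / p * (c \<bullet> x)" for i
        by (simp only: sum_subtractf sum_distrib_left[symmetric] matrix_vector_mult_def
            inner_vec_def inner_real_def vec_lambda_beta)
      then show ?thesis by (simp add: vec_eq_iff mult.commute)
    qed
    then show ?thesis
      by (simp add: inner_diff_right power2_eq_square inner_commute)
  qed
  have "psd P'"
    unfolding psd_def
  proof (intro conjI allI)
    show "transpose P' = P'"
      by (simp add: P'_def transpose_def vec_eq_iff mult.commute sym)
    fix x
    have "(x \<bullet> c)\<^sup>2 \<le> (x \<bullet> (P *v x)) * p"
      using psd_Cauchy_Schwarz[OF insert.prems(1), of x "axis k 1"]
      by (simp add: axis_form c_def p_def)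
    moreover have "0 \<le> x \<bullet> (P *v x)"
      using insert.prems(1) by (simp add: psd_def)
    ultimately show "0 \<le> x \<bullet> (P' *v x)"
      using p0 by (cases "p = 0") (simp_all add: form field_simps)
  qed
  moreover have "P' $ i $ j = 0" if "i \<notin> F" for i j
  proof (cases "i = k")
    case True
    then show ?thesis
      using row[of j] sym[of j k] by (cases "p = 0") (simp_all add: P'_def c p_def)
  next
    case False
    then show ?thesis
      using that insert.prems(2)[of i] by (simp add: P'_def c)
  qed
  ultimately obtain v :: "'n \<Rightarrow> real^'n"
    where v: "\<And>i j. P' $ i $ j = (\<Sum>k\<in>F. v k $ i * v k $ j)"
    using insert.IH[of P'] by blast
  define w where "w = v(k := (1 / sqrt p) *\<^sub>R c)"
  have "P $ i $ j = (\<Sum>l\<in>insert k F. w l $ i * w l $ j)" for i j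
  proof -
    have "(\<Sum>l\<in>F. w l $ i * w l $ j) = P' $ i $ j"
      unfolding v using insert.hyps(2) by (intro sum.cong) (auto simp: w_def)
    moreover have "w k $ i * w k $ j = c $ i * c $ j / p"
      using p0 by (simp add: w_def)
    ultimately show ?thesis
      using insert.hyps by (simp add: P'_def)
  qed
  then show ?case by blast
qed

lemma psd_factorization:
  fixes P :: "real^'n^'n"
  assumes "psd P"
  shows "\<exists>L :: real^'n^'n. L ** transpose L = P"
proof -
  obtain v :: "'n \<Rightarrow> real^'n" where v: "\<And>i j. P $ i $ j = (\<Sum>k\<in>UNIV. v k $ i * v k $ j)"
    using psd_sum_rank_one[of UNIV P] assms by auto
  have "(\<chi> i k. v k $ i) ** transpose (\<chi> i k. v k $ i) = P"
    by (simp add: vec_eq_iff matrix_matrix_mult_def transpose_def v)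
  then show ?thesis by blast
qed

lemma factor_entry_bound:
  fixes L :: "real^'n^'n"
  assumes "L ** transpose L = P"
  shows "(L $ i $ j)\<^sup>2 \<le> P $ i $ i"
proof -
  have "(L $ i $ j)\<^sup>2 \<le> (\<Sum>k\<in>UNIV. (L $ i $ k)\<^sup>2)"
    by (rule member_le_sum) auto
  also have "\<dots> = P $ i $ i"
    unfolding assms[symmetric] by (simp add: matrix_matrix_mult_def transpose_def power2_eq_square)
  finally show ?thesis .
qed

lemma bounded_matrices:
  fixes S :: "(real^'n^'m) set"
  assumes "\<And>M i j. M \<in> S \<Longrightarrow> (M $ i $ j)\<^sup>2 \<le> c i j"
  shows "bounded S"
proof (rule boundedI)
  fix M assume M: "M \<in> S"
  have "norm M \<le> (\<Sum>i\<in>UNIV. norm (M $ i))"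
    unfolding norm_vec_def by (rule L2_set_le_sum) simp
  also have "\<dots> \<le> (\<Sum>i\<in>UNIV. \<Sum>j\<in>UNIV. \<bar>M $ i $ j\<bar>)"
    by (intro sum_mono norm_le_l1_cart)
  also have "\<dots> \<le> (\<Sum>i\<in>UNIV. \<Sum>j\<in>UNIV. sqrt (c i j))"
    by (intro sum_mono real_le_rsqrt) (simp add: assms[OF M])
  finally show "norm M \<le> (\<Sum>i\<in>UNIV. \<Sum>j\<in>UNIV. sqrt (c i j))" .
qed

lemma continuous_on_trace [continuous_intros]:
  fixes f :: "'a::topological_space \<Rightarrow> real^'n^'n"
  assumes "continuous_on S f"
  shows "continuous_on S (\<lambda>x. trace (f x))"
  unfolding trace_def by (intro continuous_intros assms)

lemma compact_factors: "compact {L :: real^'n^'n. L ** transpose L = P}"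
proof (rule compact_eq_bounded_closed[THEN iffD2], intro conjI)
  show "bounded {L :: real^'n^'n. L ** transpose L = P}"
    using factor_entry_bound by (intro bounded_matrices[where c = "\<lambda>i j. P $ i $ i"]) blast
  have "{L :: real^'n^'n. L ** transpose L = P} =
        (\<Inter>i. \<Inter>j. {L. (\<Sum>k\<in>UNIV. L $ i $ k * L $ j $ k) = P $ i $ j})"
    by (auto simp: vec_eq_iff matrix_matrix_mult_def transpose_def)
  also have "closed \<dots>"
    by (intro closed_INT ballI closed_Collect_eq continuous_intros)
  finally show "closed {L :: real^'n^'n. L ** transpose L = P}" .
qed

definition reflection :: "real^'n \<Rightarrow> real^'n^'n" where
  "reflection a = (\<chi> i j. mat 1 $ i $ j - 2 / (a \<bullet> a) * a $ i * a $ j)"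

lemma reflection_apply:
  fixes a x :: "real^'n"
  shows "reflection a *v x = x - (2 * (a \<bullet> x) / (a \<bullet> a)) *\<^sub>R a"
proof -
  have "(\<Sum>j\<in>UNIV. mat 1 $ i $ j * x $ j) = x $ i" for i
    using matrix_vector_mul_lid[of x] unfolding matrix_vector_mult_def vec_eq_iff by simp
  moreover have "(reflection a *v x) $ i =
      (\<Sum>j\<in>UNIV. mat 1 $ i $ j * x $ j) - (\<Sum>j\<in>UNIV. 2 / (a \<bullet> a) * a $ i * (a $ j * x $ j))" for i
    by (simp add: reflection_def matrix_vector_mult_def left_diff_distrib sum_subtractf mult.assoc)
  moreover have "(\<Sum>j\<in>UNIV. 2 / (a \<bullet> a) * a $ i * (a $ j * x $ j)) = 2 / (a \<bullet> a) * a $ i * (a \<bullet> x)" for i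
    unfolding inner_vec_def[of a x] by (simp only: sum_distrib_left inner_real_def)
  ultimately have "(reflection a *v x) $ i = x $ i - 2 / (a \<bullet> a) * a $ i * (a \<bullet> x)" for i
    by presburger
  then show ?thesis
    by (simp add: vec_eq_iff mult_ac)
qed

lemma transpose_reflection: "transpose (reflection a) = reflection a"
  by (simp add: vec_eq_iff reflection_def transpose_def mat_def mult.commute)

lemma reflection_orthogonal: "reflection a ** transpose (reflection a) = mat 1"
proof -
  have "reflection a *v (reflection a *v x) = x" for x
    by (cases "a = 0") (simp_all add: reflection_apply inner_diff_right)
  then show ?thesis
    unfolding transpose_reflection matrix_eq by (simp add: matrix_vector_mul_assoc[symmetric])
qed

lemma trace_mult_reflection:
  fixes M :: "real^'n^'n"
  shows "trace (M ** reflection a) = trace M - 2 * (a \<bullet> (M *v a)) / (a \<bullet> a)"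
proof -
  have "(M ** reflection a) $ i $ i =
        M $ i $ i - 2 / (a \<bullet> a) * (a $ i * (M *v a) $ i)" for i
  proof -
    have "(M ** reflection a) $ i $ i = (M ** mat 1) $ i $ i - 2 / (a \<bullet> a) * (a $ i * (M *v a) $ i)"
      unfolding matrix_matrix_mult_def matrix_vector_mult_def reflection_def
      by (simp add: right_diff_distrib sum_subtractf sum_distrib_left ac_simps)
    then show ?thesis by simp
  qed
  then show ?thesis
    by (simp add: trace_def sum_subtractf inner_vec_def sum_distrib_left sum_divide_distrib)
qed

text \<open>Reflections suffice as test matrices: multiplying by one of them tests the sign of the
  quadratic form, and multiplying by two nearly equal ones, that is, by a small rotation, tests its
  symmetry.\<close>

lemma max_trace_psd:
  fixes U :: "real^'n^'n"
  assumes max: "\<And>Q. Q ** transpose Q = mat 1 \<Longrightarrow> trace (U ** Q) \<le> trace U"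
  shows "psd U"
  unfolding psd_def
proof
  have two: "trace (U ** reflection a ** reflection b) \<le> trace U" for a b
  proof -
    have "(reflection a ** reflection b) ** transpose (reflection a ** reflection b) =
          reflection a ** (reflection b ** transpose (reflection b)) ** transpose (reflection a)"
      by (simp add: matrix_transpose_mul matrix_mul_assoc)
    also have "\<dots> = mat 1"
      by (simp add: reflection_orthogonal)
    finally show ?thesis
      using max by (simp add: matrix_mul_assoc[symmetric])
  qed
  have "U $ i $ j = U $ j $ i" if "i \<noteq> j" for i j
  proof -
    define a e :: "real^'n" where "a = axis i 1" and "e = axis j 1"
    have ae: "a \<bullet> a = 1" "e \<bullet> e = 1" "a \<bullet> e = 0" "e \<bullet> a = 0"
      using that by (auto simp: a_def e_def inner_axis_axis)
    let ?d = "a \<bullet> (U *v e) - e \<bullet> (U *v a)"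
    have "(?d / 2)\<^sup>2 \<le> (a \<bullet> (U *v a) + e \<bullet> (U *v e)) * 0"
    proof (rule quadratic_nonneg_discriminant)
      fix t :: real
      \<comment> \<open>To first order in \<open>t\<close> the product of the reflections in \<open>a\<close> and \<open>b\<close> is a rotation by
        \<open>2 t\<close> in the plane of \<open>a\<close> and \<open>e\<close>.\<close>
      define b where "b = a + t *\<^sub>R e"
      have bb: "b \<bullet> b = 1 + t\<^sup>2" and ab: "a \<bullet> b = 1"
        by (simp_all add: b_def inner_add_left inner_add_right ae power2_eq_square)
      have pos: "1 + t\<^sup>2 > 0" by (simp add: add_pos_nonneg)
      have "(U ** reflection a) *v b = U *v b - 2 *\<^sub>R (U *v a)"
        by (simp add: matrix_vector_mul_assoc[symmetric] reflection_apply ab ae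
            matrix_vector_mult_diff_distrib matrix_vector_mult_scaleR)
      then have "trace (U ** reflection a ** reflection b) =
          trace U - 2 * (a \<bullet> (U *v a)) - 2 * (b \<bullet> (U *v b) - 2 * (b \<bullet> (U *v a))) / (1 + t\<^sup>2)"
        by (simp add: trace_mult_reflection bb ae inner_diff_right)
      with two[of a b]
      have "- (a \<bullet> (U *v a)) \<le> (b \<bullet> (U *v b) - 2 * (b \<bullet> (U *v a))) / (1 + t\<^sup>2)"
        by linarith
      then have "0 \<le> a \<bullet> (U *v a) + (b \<bullet> (U *v b) - 2 * (b \<bullet> (U *v a))) / (1 + t\<^sup>2)"
        by simp
      then have "0 \<le> (1 + t\<^sup>2) * (a \<bullet> (U *v a) + (b \<bullet> (U *v b) - 2 * (b \<bullet> (U *v a))) / (1 + t\<^sup>2))"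
        using pos by (intro mult_nonneg_nonneg) auto
      also have "\<dots> = (1 + t\<^sup>2) * (a \<bullet> (U *v a)) + (b \<bullet> (U *v b) - 2 * (b \<bullet> (U *v a)))"
        using pos by (simp add: distrib_left)
      also have "\<dots> = (a \<bullet> (U *v a) + e \<bullet> (U *v e)) * t\<^sup>2 + 2 * (?d / 2) * t + 0"
        by (simp add: b_def matrix_vector_right_distrib matrix_vector_mult_scaleR
            inner_add_left inner_add_right power2_eq_square algebra_simps)
          (simp add: field_simps)
      finally show "0 \<le> \<dots>" .
    qed
    then show ?thesis by (simp add: a_def e_def axis_form)
  qed
  then show "transpose U = U"
    by (simp add: vec_eq_iff transpose_def) metis
  show "\<forall>x. 0 \<le> x \<bullet> (U *v x)"
  proof
    fix x :: "real^'n"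
    have "(x \<bullet> (U *v x)) / (x \<bullet> x) \<ge> 0"
      using max[OF reflection_orthogonal[of x]] by (simp add: trace_mult_reflection)
    then have "0 \<le> (x \<bullet> (U *v x)) / (x \<bullet> x) * (x \<bullet> x)"
      by (intro mult_nonneg_nonneg inner_ge_zero)
    then show "0 \<le> x \<bullet> (U *v x)"
      by (cases "x = 0") simp_all
  qed
qed

lemma psd_sqrt_exists:
  fixes P :: "real^'n^'n"
  assumes "psd P"
  shows "\<exists>S. psd S \<and> S ** S = P"
proof -
  let ?F = "{L :: real^'n^'n. L ** transpose L = P}"
  have "?F \<noteq> {}" using psd_factorization[OF assms] by blast
  then obtain U where U: "U ** transpose U = P" and max: "\<And>L. L \<in> ?F \<Longrightarrow> trace L \<le> trace U"
    using continuous_attains_sup[OF compact_factors, of P trace] continuous_on_trace[OF continuous_on_id]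
    by blast
  have "psd U"
  proof (rule max_trace_psd)
    fix Q :: "real^'n^'n" assume Q: "Q ** transpose Q = mat 1"
    have "(U ** Q) ** transpose (U ** Q) = U ** (Q ** transpose Q) ** transpose U"
      by (simp add: matrix_transpose_mul matrix_mul_assoc)
    then show "trace (U ** Q) \<le> trace U" using max Q U by simp
  qed
  then show ?thesis using U by (metis psd_def)
qed

text \<open>If \<open>S\<^sup>2 = T\<^sup>2\<close> and \<open>\<Delta> = S - T\<close> then \<open>S \<Delta> + \<Delta> T = 0\<close>, so the nonnegative traces of
  \<open>\<Delta> S \<Delta>\<close> and \<open>\<Delta> T \<Delta>\<close> add up to zero. Hence \<open>S\<close> and \<open>T\<close>, and with them \<open>\<Delta>\<close>, annihilate the
  columns of \<open>\<Delta>\<close>.\<close>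

lemma psd_sqrt_unique:
  fixes S T :: "real^'n^'n"
  assumes S: "psd S" and T: "psd T" and eq: "S ** S = T ** T"
  shows "S = T"
proof -
  define R where "R = S - T"
  have symR: "transpose R = R"
    using S T by (simp add: R_def psd_def vec_eq_iff transpose_def)
  have "S *v (S *v x) = T *v (T *v x)" for x
    by (simp add: matrix_vector_mul_assoc eq)
  then have "S ** R + R ** T = 0"
    by (simp add: matrix_eq R_def matrix_vector_mult_add_rdistrib matrix_vector_mul_assoc[symmetric]
        matrix_vector_mult_diff_rdistrib matrix_vector_mult_diff_distrib)
  then have "R ** (S ** R) + R ** (R ** T) = 0"
    by (metis matrix_add_ldistrib matrix_eq matrix_vector_mul_assoc matrix_vector_mult_0 matrix_vector_mult_0_right)
  then have "trace (R ** (S ** R)) + trace (R ** (R ** T)) = 0"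
    unfolding trace_add[symmetric] by (simp add: trace_def)
  moreover have "trace (R ** (R ** T)) = trace (R ** (T ** R))"
    using trace_mul_sym[of R "R ** T"] by (simp add: matrix_mul_assoc)
  moreover have tr: "trace (R ** (M ** R)) = (\<Sum>i\<in>UNIV. (R *v axis i 1) \<bullet> (M *v (R *v axis i 1)))"
    for M :: "real^'n^'n"
  proof -
    have "(R ** (M ** R)) $ i $ i = (R *v axis i 1) \<bullet> (M *v (R *v axis i 1))" for i
    proof -
      have "(R ** (M ** R)) $ i $ i = axis i 1 \<bullet> (R *v (M *v (R *v axis i 1)))"
        by (simp only: axis_form matrix_vector_mul_assoc matrix_mul_assoc)
      also have "\<dots> = (M *v (R *v axis i 1)) \<bullet> (R *v axis i 1)"
        using symR by (rule symmetric_form)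
      finally show ?thesis by (simp add: inner_commute)
    qed
    then show ?thesis by (simp add: trace_def)
  qed
  ultimately have sum0: "(\<Sum>i\<in>UNIV. (R *v axis i 1) \<bullet> (S *v (R *v axis i 1))) +
      (\<Sum>i\<in>UNIV. (R *v axis i 1) \<bullet> (T *v (R *v axis i 1))) = 0"
    by simp
  have nn: "0 \<le> x \<bullet> (S *v x)" "0 \<le> x \<bullet> (T *v x)" for x
    using S T by (auto simp: psd_def)
  have "(\<Sum>i\<in>UNIV. (R *v axis i 1) \<bullet> (S *v (R *v axis i 1))) = 0"
       "(\<Sum>i\<in>UNIV. (R *v axis i 1) \<bullet> (T *v (R *v axis i 1))) = 0"
    using sum0 by (simp_all add: add_nonneg_eq_0_iff sum_nonneg nn)
  then have "(R *v axis i 1) \<bullet> (S *v (R *v axis i 1)) = 0"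
            "(R *v axis i 1) \<bullet> (T *v (R *v axis i 1)) = 0" for i
    by (simp_all add: sum_nonneg_eq_0_iff nn)
  then have "S *v (R *v axis i 1) = 0" "T *v (R *v axis i 1) = 0" for i
    using psd_kernel S T by blast+
  then have RR: "R *v (R *v axis i 1) = 0" for i
    by (simp add: R_def matrix_vector_mult_diff_rdistrib)
  have "R *v axis i 1 = 0" for i
    using symmetric_form[OF symR, of "axis i 1" "R *v axis i 1"] RR[of i] by simp
  then have "R = 0"
    by (metis axis_form inner_zero_right vec_eq_iff zero_index)
  then show ?thesis by (simp add: R_def)
qed

lemma psd_sqrt_eqI:
  assumes "psd S" and "S ** S = M"
  shows "psd_sqrt M = S"
  unfolding psd_sqrt_def
proof (rule the_equality)
  fix T assume "psd T \<and> T ** T = M"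
  then show "T = S" using psd_sqrt_unique[of T S] assms by simp
qed (use assms in blast)

lemma psd_sqrt_props:
  assumes "psd M"
  shows "psd (psd_sqrt M)" and "psd_sqrt M ** psd_sqrt M = M"
proof -
  obtain S where "psd S" "S ** S = M" using psd_sqrt_exists[OF assms] by blast
  then show "psd (psd_sqrt M)" and "psd_sqrt M ** psd_sqrt M = M" by (simp_all add: psd_sqrt_eqI)
qed

lemma psd_scaleR:
  fixes M :: "real^'n^'n"
  assumes "psd M" and "0 \<le> \<alpha>"
  shows "psd (\<alpha> *\<^sub>R M)"
  using assms unfolding psd_def
  by (auto simp only: transpose_scalar scaleR_matrix_vector_assoc[symmetric] inner_scaleR_right
      intro!: mult_nonneg_nonneg)

lemma psd_scaled_identity: "0 \<le> \<alpha> \<Longrightarrow> psd (\<alpha> *\<^sub>R mat 1 :: real^'n^'n)"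
  by (rule psd_scaleR) (simp_all add: psd_def)

lemma psd_sqrt_scaled_identity:
  assumes "0 \<le> \<alpha>"
  shows "psd_sqrt (\<alpha> *\<^sub>R mat 1 :: real^'n^'n) = sqrt \<alpha> *\<^sub>R mat 1"
  by (rule psd_sqrt_eqI) (use assms in \<open>simp_all add: psd_scaled_identity scalar_matrix_assoc[symmetric] matrix_scalar_ac\<close>)

section \<open>The shaping problem with a small multiple of the identity\<close>

text \<open>Both the cross term of the distance and every feasible \<open>U\<close> have diagonal entries of size
  \<open>O(sqrt \<alpha>)\<close>, so this lemma serves both limits.\<close>

lemma cost_tendsto_trace:
  fixes P :: "real^'n^'n"
  assumes "\<And>\<alpha> i. \<alpha> > 0 \<Longrightarrow> (V \<alpha> $ i $ i)\<^sup>2 \<le> \<alpha> * P $ i $ i"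
  shows "((\<lambda>\<alpha>. trace (P + \<alpha> *\<^sub>R mat 1 - 2 *\<^sub>R V \<alpha>)) \<longlongrightarrow> trace P) (at_right 0)"
proof -
  have V: "((\<lambda>\<alpha>. V \<alpha> $ i $ i) \<longlongrightarrow> 0) (at_right 0)" for i
  proof (rule Lim_null_comparison)
    show "\<forall>\<^sub>F \<alpha> in at_right 0. norm (V \<alpha> $ i $ i) \<le> sqrt (\<alpha> * P $ i $ i)"
      by (rule eventually_at_right_less[THEN eventually_mono])
        (auto intro!: real_le_rsqrt assms)
    have "((\<lambda>\<alpha>. sqrt (\<alpha> * P $ i $ i)) \<longlongrightarrow> sqrt (0 * P $ i $ i)) (at_right 0)"
      by (intro tendsto_intros)
    then show "((\<lambda>\<alpha>. sqrt (\<alpha> * P $ i $ i)) \<longlongrightarrow> 0) (at_right 0)" by simp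
  qed
  have "((\<lambda>\<alpha>. \<Sum>i\<in>UNIV. P $ i $ i + \<alpha> * 1 - 2 * V \<alpha> $ i $ i) \<longlongrightarrow>
      (\<Sum>i\<in>UNIV. P $ i $ i + 0 * 1 - 2 * 0)) (at_right 0)"
    by (intro tendsto_intros V)
  then show ?thesis by (simp add: trace_def mat_def)
qed

lemma bures_wasserstein_tendsto_trace:
  fixes P :: "real^'n^'n"
  assumes "psd P"
  shows "((\<lambda>\<alpha>. (bures_wasserstein_dist P (\<alpha> *\<^sub>R mat 1))\<^sup>2) \<longlongrightarrow> trace P) (at_right 0)"
proof -
  let ?S = "\<lambda>\<alpha>. psd_sqrt (\<alpha> *\<^sub>R P)"
  have bound: "(?S \<alpha> $ i $ i)\<^sup>2 \<le> \<alpha> * P $ i $ i" if "\<alpha> > 0" for \<alpha> i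
  proof -
    have "psd (\<alpha> *\<^sub>R P)"
      using that assms by (intro psd_scaleR) auto
    from psd_sqrt_props[OF this] show ?thesis
      using factor_entry_bound[of "?S \<alpha>" "\<alpha> *\<^sub>R P" i i] by (simp add: psd_def)
  qed
  have lim: "((\<lambda>\<alpha>. \<bar>trace (P + \<alpha> *\<^sub>R mat 1 - 2 *\<^sub>R ?S \<alpha>)\<bar>) \<longlongrightarrow> \<bar>trace P\<bar>) (at_right 0)"
    using bound by (intro tendsto_rabs cost_tendsto_trace)
  have "P $ i $ i \<ge> 0" for i
    using assms axis_form[of i P i] unfolding psd_def by metis
  then have abs: "\<bar>trace P\<bar> = trace P"
    by (simp add: trace_def sum_nonneg)
  \<comment> \<open>Squaring undoes the root only up to an absolute value, since the root of a negative number is negative.\<close>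
  have "\<bar>trace (P + \<alpha> *\<^sub>R mat 1 - 2 *\<^sub>R ?S \<alpha>)\<bar> = (bures_wasserstein_dist P (\<alpha> *\<^sub>R mat 1))\<^sup>2"
    if "\<alpha> > 0" for \<alpha>
  proof -
    have "psd_sqrt (\<alpha> *\<^sub>R mat 1) ** P ** psd_sqrt (\<alpha> *\<^sub>R mat 1) = \<alpha> *\<^sub>R P"
      using that by (simp add: psd_sqrt_scaled_identity scalar_matrix_assoc[symmetric] matrix_scalar_ac)
    moreover have "(sqrt x)\<^sup>2 = \<bar>x\<bar>" for x :: real
      by (metis real_sqrt_abs real_sqrt_power)
    ultimately show ?thesis by (simp add: bures_wasserstein_dist_def)
  qed
  then have "\<forall>\<^sub>F \<alpha> in at_right 0. \<bar>trace (P + \<alpha> *\<^sub>R mat 1 - 2 *\<^sub>R ?S \<alpha>)\<bar> =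
      (bures_wasserstein_dist P (\<alpha> *\<^sub>R mat 1))\<^sup>2"
    by (intro eventually_at_right_less[THEN eventually_mono])
  from Lim_transform_eventually[OF lim this] show ?thesis
    by (simp only: abs)
qed

lemma zero_in_shaping_lmi:
  fixes P Q :: "real^'n^'n"
  assumes "psd P" and "psd Q"
  shows "0 \<in> shaping_lmi P Q"
proof -
  let ?M = "block_matrix P 0 (transpose 0) Q :: real^('n + 'n)^('n + 'n)"
  have sums: "(\<Sum>i\<in>UNIV. f i) = (\<Sum>i\<in>UNIV. f (Inl i)) + (\<Sum>i\<in>UNIV. f (Inr i))"
    for f :: "'n + 'n \<Rightarrow> real"
    using sum.Plus[of UNIV UNIV f] by (simp add: UNIV_Plus_UNIV o_def)
  have entries: "?M $ Inl i $ Inl j = P $ i $ j" "?M $ Inr i $ Inr j = Q $ i $ j"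
      "?M $ Inl i $ Inr j = 0" "?M $ Inr i $ Inl j = 0" for i j
    by (simp_all add: block_matrix_def transpose_def)
  have "transpose ?M = ?M"
  proof -
    have "?M $ j $ i = ?M $ i $ j" for i j
    proof -
      have "P $ k $ l = P $ l $ k" "Q $ k $ l = Q $ l $ k" for k l
        using assms unfolding psd_def by (blast intro: symmetric_entry)+
      then show ?thesis by (cases i; cases j) (simp_all add: entries)
    qed
    then show ?thesis by (simp add: transpose_def vec_eq_iff)
  qed
  moreover have "0 \<le> x \<bullet> (?M *v x)" for x
  proof -
    have "x \<bullet> (?M *v x) = (\<chi> i. x $ Inl i) \<bullet> (P *v (\<chi> i. x $ Inl i)) +
        (\<chi> i. x $ Inr i) \<bullet> (Q *v (\<chi> i. x $ Inr i))"
      by (simp add: inner_vec_def matrix_vector_mult_def sums entries)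
    then show ?thesis using assms by (simp add: psd_def)
  qed
  ultimately show ?thesis by (simp add: shaping_lmi_def psd_def)
qed

lemma shaping_lmi_entry_bound:
  assumes "U \<in> shaping_lmi P Q"
  shows "(U $ i $ j)\<^sup>2 \<le> P $ i $ i * Q $ j $ j"
  using psd_entry_bound[of "block_matrix P U (transpose U) Q" "Inl i" "Inr j"] assms
  by (simp add: shaping_lmi_def block_matrix_def)

text \<open>Boundedness comes from the \<open>2 \<times> 2\<close> principal minors that meet both diagonal blocks.\<close>

lemma compact_shaping_lmi: "compact (shaping_lmi P Q)"
proof (rule compact_eq_bounded_closed[THEN iffD2], intro conjI)
  show "bounded (shaping_lmi P Q)"
    by (rule bounded_matrices) (rule shaping_lmi_entry_bound)
  have cont: "continuous_on UNIV (\<lambda>U. block_matrix P U (transpose U) Q $ i $ j)" for i j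
    by (cases i; cases j) (simp_all add: block_matrix_def transpose_def continuous_intros)
  have "shaping_lmi P Q =
      (\<Inter>i. \<Inter>j. {U. block_matrix P U (transpose U) Q $ j $ i = block_matrix P U (transpose U) Q $ i $ j})
      \<inter> (\<Inter>x. {U. 0 \<le> (\<Sum>i\<in>UNIV. x $ i * (\<Sum>j\<in>UNIV. block_matrix P U (transpose U) Q $ i $ j * x $ j))})"
    by (auto simp: shaping_lmi_def psd_def vec_eq_iff transpose_def[of "block_matrix _ _ _ _"]
        inner_vec_def matrix_vector_mult_def)
  also have "closed \<dots>"
    by (intro closed_Int closed_INT ballI closed_Collect_eq closed_Collect_le continuous_intros cont)
  finally show "closed (shaping_lmi P Q)" .
qed

lemma shaping_cost_attains_min:
  assumes "psd P" and "psd Q"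
  shows "\<exists>U \<in> shaping_lmi P Q. \<forall>V \<in> shaping_lmi P Q. shaping_cost P Q U \<le> shaping_cost P Q V"
proof (rule continuous_attains_inf)
  show "shaping_lmi P Q \<noteq> {}"
    using zero_in_shaping_lmi[OF assms] by blast
  show "continuous_on (shaping_lmi P Q) (shaping_cost P Q)"
    unfolding shaping_cost_def by (intro continuous_intros)
qed (rule compact_shaping_lmi)

lemma min_shaping_cost_tendsto_trace:
  fixes P :: "real^'n^'n"
  assumes "psd P"
  shows "((\<lambda>\<alpha>. INF U \<in> shaping_lmi P (\<alpha> *\<^sub>R mat 1). shaping_cost P (\<alpha> *\<^sub>R mat 1) U)
           \<longlongrightarrow> trace P) (at_right 0)"
proof -
  have "\<exists>U \<in> shaping_lmi P (\<alpha> *\<^sub>R mat 1). \<forall>V \<in> shaping_lmi P (\<alpha> *\<^sub>R mat 1).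
      shaping_cost P (\<alpha> *\<^sub>R mat 1) U \<le> shaping_cost P (\<alpha> *\<^sub>R mat 1) V" if "\<alpha> > 0" for \<alpha> :: real
    using that by (intro shaping_cost_attains_min assms psd_scaled_identity) simp
  then obtain U where U: "\<And>\<alpha>. \<alpha> > 0 \<Longrightarrow> U \<alpha> \<in> shaping_lmi P (\<alpha> *\<^sub>R mat 1)"
    and min: "\<And>\<alpha> V. \<alpha> > 0 \<Longrightarrow> V \<in> shaping_lmi P (\<alpha> *\<^sub>R mat 1) \<Longrightarrow>
      shaping_cost P (\<alpha> *\<^sub>R mat 1) (U \<alpha>) \<le> shaping_cost P (\<alpha> *\<^sub>R mat 1) V"
    by metis
  have "(U \<alpha> $ i $ i)\<^sup>2 \<le> \<alpha> * P $ i $ i" if "\<alpha> > 0" for \<alpha> i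
    using shaping_lmi_entry_bound[OF U[OF that], of i i] by (simp add: mat_def mult.commute)
  then have "((\<lambda>\<alpha>. shaping_cost P (\<alpha> *\<^sub>R mat 1) (U \<alpha>)) \<longlongrightarrow> trace P) (at_right 0)"
    unfolding shaping_cost_def by (rule cost_tendsto_trace)
  moreover have "shaping_cost P (\<alpha> *\<^sub>R mat 1) (U \<alpha>) =
      (INF U \<in> shaping_lmi P (\<alpha> *\<^sub>R mat 1). shaping_cost P (\<alpha> *\<^sub>R mat 1) U)" if "\<alpha> > 0" for \<alpha>
    using U[OF that] min[OF that] by (intro cInf_eq_minimum[symmetric]) auto
  then have "\<forall>\<^sub>F \<alpha> in at_right 0. shaping_cost P (\<alpha> *\<^sub>R mat 1) (U \<alpha>) =
      (INF U \<in> shaping_lmi P (\<alpha> *\<^sub>R mat 1). shaping_cost P (\<alpha> *\<^sub>R mat 1) U)"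
    by (intro eventually_at_right_less[THEN eventually_mono])
  ultimately show ?thesis by (rule Lim_transform_eventually)
qed

theorem mainTheorem4:
  fixes A :: "real^'n^'n" and B :: "real^'m^'n" and D :: "real^'r^'n"
  assumes "controllable A B" and "controllable A D"
  shows "(\<forall>P :: real^'n^'n. pos_def P \<longrightarrow>
            ((\<lambda>\<alpha>. (bures_wasserstein_dist P (\<alpha> *\<^sub>R mat 1))\<^sup>2) \<longlongrightarrow> trace P) (at_right 0))
       \<and> (\<forall>\<alpha>>0. {(P, E). \<exists>U. (P, E, U) \<in> shaping_feasible A B D (\<alpha> *\<^sub>R mat 1)}
            = h2_feasible A B D)
       \<and> (\<forall>(P, E) \<in> h2_feasible A B D.
            (\<forall>\<alpha>>0. \<exists>U \<in> shaping_lmi P (\<alpha> *\<^sub>R mat 1). \<forall>V \<in> shaping_lmi P (\<alpha> *\<^sub>R mat 1).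
               shaping_cost P (\<alpha> *\<^sub>R mat 1) U \<le> shaping_cost P (\<alpha> *\<^sub>R mat 1) V)
          \<and> ((\<lambda>\<alpha>. INF U \<in> shaping_lmi P (\<alpha> *\<^sub>R mat 1). shaping_cost P (\<alpha> *\<^sub>R mat 1) U)
               \<longlongrightarrow> trace P) (at_right 0))"
proof (intro conjI allI impI ballI)
  fix P :: "real^'n^'n" assume "pos_def P"
  then show "((\<lambda>\<alpha>. (bures_wasserstein_dist P (\<alpha> *\<^sub>R mat 1))\<^sup>2) \<longlongrightarrow> trace P) (at_right 0)"
    by (intro bures_wasserstein_tendsto_trace pos_def_imp_psd)
next
  fix \<alpha> :: real assume "\<alpha> > 0"
  then have "0 \<in> shaping_lmi P (\<alpha> *\<^sub>R mat 1)" if "pos_def P" for P :: "real^'n^'n"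
    using that by (intro zero_in_shaping_lmi pos_def_imp_psd psd_scaled_identity) auto
  then show "{(P, E). \<exists>U. (P, E, U) \<in> shaping_feasible A B D (\<alpha> *\<^sub>R mat 1)} = h2_feasible A B D"
    by (auto simp: shaping_feasible_def h2_feasible_def)
next
  fix x assume "x \<in> h2_feasible A B D"
  then obtain P E where x: "x = (P, E)" and "psd P"
    by (auto simp: h2_feasible_def pos_def_imp_psd)
  then show "case x of (P, E) \<Rightarrow>
            (\<forall>\<alpha>>0. \<exists>U \<in> shaping_lmi P (\<alpha> *\<^sub>R mat 1). \<forall>V \<in> shaping_lmi P (\<alpha> *\<^sub>R mat 1).
               shaping_cost P (\<alpha> *\<^sub>R mat 1) U \<le> shaping_cost P (\<alpha> *\<^sub>R mat 1) V)
          \<and> ((\<lambda>\<alpha>. INF U \<in> shaping_lmi P (\<alpha> *\<^sub>R mat 1). shaping_cost P (\<alpha> *\<^sub>R mat 1) U)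
               \<longlongrightarrow> trace P) (at_right 0)"
    by (auto intro!: min_shaping_cost_tendsto_trace shaping_cost_attains_min psd_scaled_identity)
qed

end
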